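(* Let $A\in\mathbb{R}^{m\times n}$ have full row rank and let $b\in\mathbb{R}^m$. Assume that the solution set of the basis pursuit problem $$\min_{x\in\mathbb{R}^n}\|x\|_1\quad\text{s.t. } Ax=b$$ is nonempty. Let $x^*\in\mathbb{R}^n$, $I:=\operatorname{supp}(x^* )$ and $s:=\operatorname{sign}(x_I^* )$. Then $x^*$ is the unique solution to the basis pursuit problem if and only if $Ax^*=b$ and both of the following hold: 1) the submatrix $A_I$ has full column rank; and 2) there is $y\in\mathbb{R}^m$ such that $A_I^Ty=s$ and $\|A_{I^c}^Ty\|_\infty<1$.
   Context: For an index set $I\subseteq\{1,\dots,n\}$, $I^c$ is its complement in $\{1,\dots,n\}$, $A_I$ is the submatrix of $A$ formed by the columns $a_i$, $i\in I$, and $x_I$ is the subvector of $x$ formed by the entries $x_i$, $i\in I$. $\operatorname{supp}(x)=\{i:x_i\ne 0\}$, and $\operatorname{sign}$ is applied entrywise. When $I=\emptyset$, $A_I$ is regarded as having full column rank and the equation $A_I^Ty=s$ is vacuous; when $I^c=\emptyset$, the condition $\|A_{I^c}^Ty\|_\infty<1$ is vacuous. *)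

theory Defs
  imports "HOL-Analysis.Analysis"
begin

definition l1_norm :: "real ^ 'n \<Rightarrow> real" where
  "l1_norm x = (\<Sum>i\<in>UNIV. \<bar>x $ i\<bar>)"

definition bp_solutions :: "real ^ 'n ^ 'm \<Rightarrow> real ^ 'm \<Rightarrow> (real ^ 'n) set" where
  "bp_solutions A b = {x. is_arg_min l1_norm (\<lambda>z. A *v z = b) x}"

definition supp :: "real ^ 'n \<Rightarrow> 'n set" where
  "supp x = {i. x $ i \<noteq> 0}"

definition sign_vec :: "real ^ 'n \<Rightarrow> real ^ 'n" where
  "sign_vec x = (\<chi> i. sgn (x $ i))"

text \<open>
  Dimensions are types, so a submatrix or subvector indexed by a set \<open>I\<close> is represented at full
  size, with the entries outside \<open>I\<close> set to zero. The padding changes neither the rank of the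
  submatrix nor the entries in \<open>I\<close> of its transpose applied to a vector, and it only adds zeros to
  vectors, so equations between padded vectors and their supremum norms agree with those of the
  unpadded ones; for empty \<open>I\<close> the rank is 0, equations are trivial, and the norm is 0.
  See \<open>rank_column_submatrix\<close>, \<open>full_column_rank_iff\<close>, \<open>column_submatrix_transpose_eq_iff\<close> and
  \<open>infnorm_column_submatrix_less_iff\<close>.
\<close>

definition column_submatrix :: "real ^ 'n ^ 'm \<Rightarrow> 'n set \<Rightarrow> real ^ 'n ^ 'm" where
  "column_submatrix A I = (\<chi> i j. if j \<in> I then A $ i $ j else 0)"

definition subvec :: "real ^ 'n \<Rightarrow> 'n set \<Rightarrow> real ^ 'n" where
  "subvec x I = (\<chi> i. if i \<in> I then x $ i else 0)"

text \<open>The number of columns of the submatrix is \<open>card I\<close>, not the padded \<open>CARD('n)\<close>.\<close>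

definition full_column_rank :: "real ^ 'n ^ 'm \<Rightarrow> 'n set \<Rightarrow> bool" where
  "full_column_rank A I \<longleftrightarrow> rank (column_submatrix A I) = card I"

lemma column_column_submatrix:
  "column j (column_submatrix A I) = (if j \<in> I then column j A else 0)"
  by (simp add: column_def column_submatrix_def vec_eq_iff)

lemma rank_column_submatrix:
  "rank (column_submatrix A I) = dim ((\<lambda>j. column j A) ` I)"
proof -
  have "columns (column_submatrix A I) \<subseteq> insert 0 ((\<lambda>j. column j A) ` I)"
    by (auto simp: columns_def column_column_submatrix)
  moreover have "(\<lambda>j. column j A) ` I \<subseteq> columns (column_submatrix A I)"
    by (force simp: columns_def column_column_submatrix)
  ultimately have "span (columns (column_submatrix A I)) = span ((\<lambda>j. column j A) ` I)"
    by (metis span_insert_0 span_mono subset_antisym)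
  then show ?thesis
    by (metis dim_span column_rank_def)
qed

lemma full_column_rank_iff:
  "full_column_rank A I \<longleftrightarrow>
     (\<forall>c. (\<Sum>j\<in>I. c j *\<^sub>R column j A) = 0 \<longrightarrow> (\<forall>j\<in>I. c j = 0))"
proof -
  let ?f = "\<lambda>j. column j A"
  have *: "full_column_rank A I \<longleftrightarrow> inj_on ?f I \<and> independent (?f ` I)"
  proof
    assume "full_column_rank A I"
    then have "dim (?f ` I) = card I"
      by (simp add: full_column_rank_def rank_column_submatrix)
    moreover have "dim (?f ` I) \<le> card (?f ` I)" "card (?f ` I) \<le> card I"
      by (simp_all add: dim_le_card' card_image_le)
    ultimately have "card (?f ` I) = card I" "card (?f ` I) \<le> dim (?f ` I)"
      by simp_all
    then show "inj_on ?f I \<and> independent (?f ` I)"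
      using card_le_dim_spanning[of "?f ` I" "?f ` I"]
      by (auto intro: eq_card_imp_inj_on simp: span_superset)
  next
    assume "inj_on ?f I \<and> independent (?f ` I)"
    then show "full_column_rank A I"
      by (simp add: full_column_rank_def rank_column_submatrix dim_eq_card_independent card_image)
  qed
  show ?thesis
  proof
    assume "full_column_rank A I"
    with * have inj: "inj_on ?f I" and ind: "independent (?f ` I)" by auto
    show "\<forall>c. (\<Sum>j\<in>I. c j *\<^sub>R ?f j) = 0 \<longrightarrow> (\<forall>j\<in>I. c j = 0)"
    proof (intro allI impI ballI)
      fix c j assume c: "(\<Sum>j\<in>I. c j *\<^sub>R ?f j) = 0" and j: "j \<in> I"
      have "(\<Sum>v\<in>?f ` I. c (the_inv_into I ?f v) *\<^sub>R v) = 0"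
        using c by (simp add: sum.reindex[OF inj] the_inv_into_f_f[OF inj])
      with ind j have "c (the_inv_into I ?f (?f j)) = 0"
        by (subst (asm) dependent_finite) auto
      then show "c j = 0"
        using j by (simp add: the_inv_into_f_f[OF inj])
    qed
  next
    assume R: "\<forall>c. (\<Sum>j\<in>I. c j *\<^sub>R ?f j) = 0 \<longrightarrow> (\<forall>j\<in>I. c j = 0)"
    have inj: "inj_on ?f I"
    proof (rule inj_onI, rule ccontr)
      fix i k assume ik: "i \<in> I" "k \<in> I" "?f i = ?f k" "i \<noteq> k"
      let ?c = "\<lambda>j. (if j = i then 1 else 0) - (if j = k then 1 else 0) :: real"
      have "(\<Sum>j\<in>I. ?c j *\<^sub>R ?f j)
          = (\<Sum>j\<in>I. if j = i then ?f j else 0) - (\<Sum>j\<in>I. if j = k then ?f j else 0)"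
        unfolding sum_subtractf[symmetric] by (rule sum.cong) auto
      also have "\<dots> = 0"
        using ik by simp
      finally have "?c i = 0"
        using R[rule_format, of ?c i] ik(1) by blast
      with ik(4) show False by simp
    qed
    moreover have "independent (?f ` I)"
    proof
      assume "dependent (?f ` I)"
      then obtain u v where u: "v \<in> ?f ` I" "u v \<noteq> 0" "(\<Sum>v\<in>?f ` I. u v *\<^sub>R v) = 0"
        by (subst (asm) dependent_finite) auto
      then have "(\<Sum>j\<in>I. u (?f j) *\<^sub>R ?f j) = 0"
        by (simp add: sum.reindex[OF inj])
      with R[rule_format, of "\<lambda>j. u (?f j)"] u show False by auto
    qed
    ultimately show "full_column_rank A I"
      using * by blast
  qed
qed

lemma transpose_column_submatrix_mult:
  "(transpose (column_submatrix A I) *v y) $ j = (if j \<in> I then column j A \<bullet> y else 0)"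
  by (simp add: matrix_vector_mult_def transpose_def column_submatrix_def column_def inner_vec_def)

lemma column_submatrix_transpose_eq_iff:
  "transpose (column_submatrix A I) *v y = sign_vec (subvec x I) \<longleftrightarrow>
     (\<forall>j\<in>I. column j A \<bullet> y = sgn (x $ j))"
  by (simp add: vec_eq_iff transpose_column_submatrix_mult sign_vec_def subvec_def
      del: transpose_matrix_vector) auto

lemma infnorm_column_submatrix_less_iff:
  "infnorm (transpose (column_submatrix A I) *v y) < 1 \<longleftrightarrow> (\<forall>j\<in>I. \<bar>column j A \<bullet> y\<bar> < 1)"
proof -
  let ?v = "transpose (column_submatrix A I) *v y"
  have "infnorm ?v = Max (range (\<lambda>j. \<bar>?v $ j\<bar>))"
    by (simp add: infnorm_cart full_SetCompr_eq cSup_eq_Max)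
  then have "infnorm ?v < 1 \<longleftrightarrow> (\<forall>j. \<bar>?v $ j\<bar> < 1)"
    by simp
  then show ?thesis
    by (auto simp: transpose_column_submatrix_mult simp del: transpose_matrix_vector)
qed

end

theory Submission
  imports Defs
begin

text \<open>
  The \<open>l1\<close> norm has a linear one-sided expansion at \<open>x\<close> in every direction, so if \<open>x\<close> is the unique
  solution, its directional derivative is positive in every nonzero kernel direction \<open>h\<close>.
  Comparing \<open>h\<close> with \<open>-h\<close> for \<open>h\<close> supported on \<open>supp x\<close> gives the rank condition. If no \<open>y\<close> existed, then
  the row space of \<open>A\<close> would be disjoint from the relatively open face
  \<open>{w. w = sign x on supp x, \<bar>w\<bar> < 1 elsewhere}\<close>; the normal of a hyperplane separating the two
  is a kernel vector along which the directional derivative is not positive. Conversely, such a \<open>y\<close> gives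
  \<open>l1_norm z \<ge> b \<bullet> y = l1_norm x\<close> for feasible \<open>z\<close>, with equality only for \<open>z\<close> supported on \<open>supp x\<close>.
\<close>

lemma vector_matrix_mult_component: "(y v* A) $ j = column j A \<bullet> (y :: real ^ 'm)"
  by (simp add: vector_matrix_mult_def column_def inner_vec_def mult.commute)

lemma inner_matrix_vector_mult:
  fixes A :: "real ^ 'n ^ 'm"
  shows "(A *v x) \<bullet> y = (\<Sum>j\<in>UNIV. x $ j * (column j A \<bullet> y))"
proof -
  have "(A *v x) \<bullet> y = (y v* A) \<bullet> x"
    by (metis dot_lmul_matrix inner_commute)
  then show ?thesis
    by (simp add: inner_vec_def vector_matrix_mult_component mult.commute)
qed

text \<open>Padding coefficients on \<open>I\<close> with zeros turns a linear relation among the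
  columns in \<open>I\<close> into a kernel vector supported in \<open>I\<close>, and
  conversely.\<close>

lemma full_column_rank_kernel_iff:
  fixes A :: "real ^ 'n ^ 'm"
  shows "full_column_rank A I \<longleftrightarrow> (\<forall>h. A *v h = 0 \<and> supp h \<subseteq> I \<longrightarrow> h = 0)"
proof -
  have sum: "(\<Sum>j\<in>I. h $ j *\<^sub>R column j A) = A *v h" if "supp h \<subseteq> I" for h
  proof -
    have "(\<Sum>j\<in>I. h $ j *\<^sub>R column j A) = (\<Sum>j\<in>UNIV. h $ j *\<^sub>R column j A)"
      using that by (intro sum.mono_neutral_left) (auto simp: supp_def)
    then show ?thesis
      by (simp add: matrix_mult_sum scalar_mult_eq_scaleR)
  qed
  show ?thesis
    unfolding full_column_rank_iff
  proof (intro iffI allI impI ballI)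
    fix h assume R: "\<forall>c. (\<Sum>j\<in>I. c j *\<^sub>R column j A) = 0 \<longrightarrow> (\<forall>j\<in>I. c j = 0)"
      and h: "A *v h = 0 \<and> supp h \<subseteq> I"
    from h R[rule_format, of "($) h"] have "\<forall>j\<in>I. h $ j = 0"
      by (auto simp: sum)
    with h show "h = 0"
      by (auto simp: vec_eq_iff supp_def)
  next
    fix c j
    assume K: "\<forall>h. A *v h = 0 \<and> supp h \<subseteq> I \<longrightarrow> h = 0"
      and c: "(\<Sum>j\<in>I. c j *\<^sub>R column j A) = 0" and j: "j \<in> I"
    define h where "h = subvec (vec_lambda c) I"
    have s: "supp h \<subseteq> I"
      by (auto simp: h_def subvec_def supp_def)
    have "(\<Sum>j\<in>I. h $ j *\<^sub>R column j A) = (\<Sum>j\<in>I. c j *\<^sub>R column j A)"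
      by (intro sum.cong) (auto simp: h_def subvec_def)
    with c s have "A *v h = 0"
      by (simp add: sum)
    with K s have "h = 0"
      by blast
    then have "h $ j = 0"
      by simp
    with j show "c j = 0"
      by (simp add: h_def subvec_def)
  qed
qed

text \<open>The one-sided directional derivative of \<open>l1_norm\<close> at \<open>x\<close> along
  \<open>h\<close>; the kinks at the zero entries of \<open>x\<close> contribute absolute
  values.\<close>

definition l1_dir_deriv :: "real ^ 'n \<Rightarrow> real ^ 'n \<Rightarrow> real" where
  "l1_dir_deriv x h = (\<Sum>i\<in>UNIV. if x $ i = 0 then \<bar>h $ i\<bar> else sgn (x $ i) * h $ i)"

text \<open>The expansion is exact, with no remainder: each coordinate is affine in \<open>t\<close>
  on some interval to the right of 0, and since there are finitely many coordinates one
  \<open>t\<close> serves them all.\<close>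

lemma l1_norm_add_scaleR:
  fixes x h :: "real ^ 'n"
  obtains t where "t > 0" "l1_norm (x + t *\<^sub>R h) = l1_norm x + t * l1_dir_deriv x h"
proof -
  have "\<forall>\<^sub>F t in at_right 0. \<bar>x $ i + t * h $ i\<bar> =
      \<bar>x $ i\<bar> + t * (if x $ i = 0 then \<bar>h $ i\<bar> else sgn (x $ i) * h $ i)" for i
  proof (cases "x $ i = 0")
    case True
    show ?thesis
      using eventually_at_right_less[of 0]
      by eventually_elim (use True in \<open>auto simp: abs_mult\<close>)
  next
    case False
    have "((\<lambda>t. t * h $ i) \<longlongrightarrow> 0 * h $ i) (at_right 0)"
      by (intro tendsto_intros)
    \<comment> \<open>Below this threshold the perturbation cannot change the sign of
      \<open>x $ i\<close>.\<close>
    then have "\<forall>\<^sub>F t in at_right 0. dist (t * h $ i) 0 < \<bar>x $ i\<bar>"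
      using False by (intro tendstoD) auto
    then show ?thesis
      by eventually_elim (use False in \<open>auto simp: sgn_if dist_real_def abs_if split: if_splits\<close>)
  qed
  then have "\<forall>\<^sub>F t in at_right 0. \<forall>i. \<bar>x $ i + t * h $ i\<bar> =
      \<bar>x $ i\<bar> + t * (if x $ i = 0 then \<bar>h $ i\<bar> else sgn (x $ i) * h $ i)"
    by (intro eventually_all_finite) blast
  with eventually_at_right_less[of 0]
  have "\<forall>\<^sub>F t in at_right 0. t > 0 \<and> (\<forall>i. \<bar>x $ i + t * h $ i\<bar> =
      \<bar>x $ i\<bar> + t * (if x $ i = 0 then \<bar>h $ i\<bar> else sgn (x $ i) * h $ i))"
    by eventually_elim blast
  then obtain t where t: "t > 0" "\<And>i. \<bar>x $ i + t * h $ i\<bar> =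
      \<bar>x $ i\<bar> + t * (if x $ i = 0 then \<bar>h $ i\<bar> else sgn (x $ i) * h $ i)"
    using eventually_happens'[OF trivial_limit_at_right_real] by blast
  then have "l1_norm (x + t *\<^sub>R h) = l1_norm x + t * l1_dir_deriv x h"
    by (simp add: l1_norm_def l1_dir_deriv_def sum.distrib sum_distrib_left)
  with t(1) show thesis by (rule that)
qed

lemma unique_bp_solution_dir_deriv_pos:
  assumes uniq: "bp_solutions A b = {x}" and h: "A *v h = 0" "h \<noteq> 0"
  shows "l1_dir_deriv x h > 0"
proof (rule ccontr)
  assume neg: "\<not> l1_dir_deriv x h > 0"
  obtain t where t: "t > 0" "l1_norm (x + t *\<^sub>R h) = l1_norm x + t * l1_dir_deriv x h"
    by (rule l1_norm_add_scaleR)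
  have le: "l1_norm (x + t *\<^sub>R h) \<le> l1_norm x"
    using t neg by (simp add: mult_le_0_iff)
  have "is_arg_min l1_norm (\<lambda>z. A *v z = b) x"
    using uniq by (auto simp: bp_solutions_def)
  \<comment> \<open>Moving along the kernel keeps feasibility, so a nonpositive derivative yields a
    second minimizer.\<close>
  then have "is_arg_min l1_norm (\<lambda>z. A *v z = b) (x + t *\<^sub>R h)"
    using le h
    by (auto simp: is_arg_min_linorder matrix_vector_right_distrib matrix_vector_mult_scaleR
        intro: order_trans)
  then have "x + t *\<^sub>R h \<in> {x}"
    using uniq by (simp add: bp_solutions_def flip: uniq)
  with t h show False by simp
qed

lemma dual_certificate_exists:
  fixes A :: "real ^ 'n ^ 'm"
  assumes pos: "\<And>h. A *v h = 0 \<Longrightarrow> h \<noteq> 0 \<Longrightarrow> l1_dir_deriv x h > 0"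
  obtains y where "\<And>j. j \<in> supp x \<Longrightarrow> column j A \<bullet> y = sgn (x $ j)"
    and "\<And>j. j \<notin> supp x \<Longrightarrow> \<bar>column j A \<bullet> y\<bar> < 1"
proof -
  \<comment> \<open>\<open>C\<close> is the relative interior of the subdifferential of
    \<open>l1_norm\<close> at \<open>x\<close>, and \<open>R\<close> is the row space of
    \<open>A\<close>; a common point \<open>y v* A\<close> provides the certificate
    \<open>y\<close>.\<close>
  define C where "C = {w :: real ^ 'n. \<forall>i. if x $ i = 0 then w $ i \<in> {-1<..<1} else w $ i \<in> {sgn (x $ i)}}"
  define R where "R = range (\<lambda>y. y v* A)"
  have "C \<inter> R \<noteq> {}"
  proof
    assume disj: "C \<inter> R = {}"
    have "C = (\<Inter>i. (\<lambda>w. w $ i) -` (if x $ i = 0 then {-1<..<1} else {sgn (x $ i)}))"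
      by (fastforce simp: C_def split: if_splits)
    moreover have "convex ((\<lambda>w :: real ^ 'n. w $ i) -` (if x $ i = 0 then {-1<..<1} else {sgn (x $ i)}))" for i
      by (intro convex_linear_vimage) (auto intro: bounded_linear.linear bounded_linear_vec_nth)
    ultimately have "convex C"
      by (auto intro: convex_INT)
    have lin: "linear (\<lambda>y. y v* A)"
      by (metis (no_types, lifting) ext matrix_vector_mul_linear transpose_matrix_vector)
    then have "subspace R"
      unfolding R_def by (rule linear_subspace_image) (rule subspace_UNIV)
    have "sign_vec x \<in> C"
      by (auto simp: C_def sign_vec_def)
    then obtain a c where ac: "a \<noteq> 0" "\<forall>w\<in>C. a \<bullet> w \<le> c" "\<forall>w\<in>R. a \<bullet> w \<ge> c"
      using separating_hyperplane_sets[OF \<open>convex C\<close> subspace_imp_convex[OF \<open>subspace R\<close>] _ _ disj]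
        subspace_0[OF \<open>subspace R\<close>] by blast
    have "c \<le> 0"
      using ac(3) subspace_0[OF \<open>subspace R\<close>] by force
    have orth: "a \<bullet> w = 0" if "w \<in> R" for w
    proof (rule ccontr)
      assume "a \<bullet> w \<noteq> 0"
      \<comment> \<open>The factor is chosen so that the inner product becomes \<open>c - 1\<close>,
        violating the lower bound \<open>c\<close> on the subspace.\<close>
      moreover have "a \<bullet> (((c - 1) / (a \<bullet> w)) *\<^sub>R w) \<ge> c"
        using ac(3) subspace_scale[OF \<open>subspace R\<close> that] by blast
      ultimately show False by simp
    qed
    \<comment> \<open>The inner product of \<open>a\<close> with this row space element is the
      squared norm of \<open>A *v a\<close>.\<close>
    have "(A *v a) v* A \<in> R"
      by (simp add: R_def)
    from orth[OF this] have "A *v a = 0"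
      by (metis dot_lmul_matrix inner_commute inner_eq_zero_iff)
    have "l1_dir_deriv x a \<le> 0"
    proof -
      \<comment> \<open>\<open>S\<close> and \<open>T\<close> split the derivative along
        \<open>a\<close> into its linear part on \<open>supp x\<close> and its kink part off
        it.\<close>
      define S where "S = (\<Sum>i\<in>UNIV. if x $ i = 0 then 0 else sgn (x $ i) * a $ i)"
      define T where "T = (\<Sum>i\<in>UNIV. if x $ i = 0 then \<bar>a $ i\<bar> else 0)"
      have "t * T \<le> - S" if t: "0 < t" "t < 1" for t
      proof -
        \<comment> \<open>Off \<open>supp x\<close>, the choice \<open>sgn (a $ i)\<close> would
          give \<open>T\<close> itself but can leave \<open>C\<close>, whose bounds are strict.
          Shrinking by \<open>t < 1\<close> stays inside, and letting \<open>t\<close> tend to 1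
          recovers \<open>T\<close>.\<close>
        let ?w = "\<chi> i. if x $ i = 0 then t * sgn (a $ i) else sgn (x $ i)"
        have "?w \<in> C"
          using t by (auto simp: C_def sgn_if)
        then have "a \<bullet> ?w \<le> 0"
          using ac(2) \<open>c \<le> 0\<close> by force
        moreover have "a \<bullet> ?w = S + t * T"
          unfolding S_def T_def inner_vec_def sum_distrib_left sum.distrib[symmetric]
          by (intro sum.cong) (auto simp: abs_sgn mult_ac)
        ultimately show ?thesis by simp
      qed
      then have "T \<le> - S"
        by (rule field_le_mult_one_interval)
      moreover have "l1_dir_deriv x a = S + T"
        unfolding l1_dir_deriv_def S_def T_def sum.distrib[symmetric]
        by (intro sum.cong) auto
      ultimately show ?thesis by simp
    qed
    with pos[OF \<open>A *v a = 0\<close> \<open>a \<noteq> 0\<close>] show False by simp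
  qed
  then obtain y where y: "y v* A \<in> C"
    by (auto simp: R_def)
  show thesis
  proof
    fix j
    have *: "if x $ j = 0 then column j A \<bullet> y \<in> {-1<..<1} else column j A \<bullet> y \<in> {sgn (x $ j)}"
      using y unfolding C_def mem_Collect_eq vector_matrix_mult_component by (rule spec)
    show "column j A \<bullet> y = sgn (x $ j)" if "j \<in> supp x"
      using * that by (simp add: supp_def)
    show "\<bar>column j A \<bullet> y\<bar> < 1" if "j \<notin> supp x"
      using * that by (simp add: supp_def abs_less_iff)
  qed
qed

lemma full_column_rank_supp:
  assumes pos: "\<And>h. A *v h = 0 \<Longrightarrow> h \<noteq> 0 \<Longrightarrow> l1_dir_deriv x h > 0"
  shows "full_column_rank A (supp x)"
  unfolding full_column_rank_kernel_iff
proof (intro allI impI, rule ccontr)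
  fix h assume h: "A *v h = 0 \<and> supp h \<subseteq> supp x" and "h \<noteq> 0"
  \<comment> \<open>The kink terms vanish because \<open>h\<close> is zero off
    \<open>supp x\<close>, so the derivative is odd here and cannot be positive at both
    \<open>h\<close> and \<open>- h\<close>.\<close>
  have "l1_dir_deriv x (- h) = - l1_dir_deriv x h"
    unfolding l1_dir_deriv_def sum_negf[symmetric]
    using h by (intro sum.cong) (auto simp: supp_def)
  moreover have "A *v (- h) = 0"
    using h by (metis matrix_vector_mult_diff_distrib diff_0 diff_zero matrix_vector_mult_0_right)
  ultimately show False
    using pos[of h] pos[of "- h"] h \<open>h \<noteq> 0\<close> by simp
qed

lemma bp_solutions_eq_singletonI:
  fixes A :: "real ^ 'n ^ 'm"
  assumes feas: "A *v x = b" and rank: "full_column_rank A (supp x)"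
    and on: "\<And>j. j \<in> supp x \<Longrightarrow> column j A \<bullet> y = sgn (x $ j)"
    and off: "\<And>j. j \<notin> supp x \<Longrightarrow> \<bar>column j A \<bullet> y\<bar> < 1"
  shows "bp_solutions A b = {x}"
proof -
  have x: "l1_norm x = b \<bullet> y"
    unfolding l1_norm_def feas[symmetric] inner_matrix_vector_mult
    by (intro sum.cong refl) (use on in \<open>force simp: supp_def abs_sgn\<close>)
  have le1: "\<bar>column j A \<bullet> y\<bar> \<le> 1" for j
    using on[of j] off[of j] by (cases "j \<in> supp x") (auto simp: sgn_if)
  have less: "l1_norm x < l1_norm z" if z: "A *v z = b" "z \<noteq> x" for z
  proof -
    have le: "z $ j * (column j A \<bullet> y) \<le> \<bar>z $ j\<bar>" for j
    proof -
      have "z $ j * (column j A \<bullet> y) \<le> \<bar>z $ j\<bar> * \<bar>column j A \<bullet> y\<bar>"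
        by (metis abs_ge_self abs_mult)
      also have "\<dots> \<le> \<bar>z $ j\<bar>"
        using le1[of j] by (simp add: mult_left_le)
      finally show ?thesis .
    qed
    \<comment> \<open>This is where the rank enters: \<open>z - x\<close> is a nonzero kernel
      vector, so it has a nonzero entry \<open>i\<close> off \<open>supp x\<close>. There
      \<open>x\<close> vanishes, hence \<open>z $ i\<close> does not, and the strict bound at
      \<open>i\<close> makes the whole sum strictly smaller.\<close>
    have "\<not> supp (z - x) \<subseteq> supp x"
      using rank[unfolded full_column_rank_kernel_iff, rule_format, of "z - x"] z feas
      by (auto simp: matrix_vector_mult_diff_distrib)
    then obtain i where i: "i \<notin> supp x" "z $ i \<noteq> 0"
      by (auto simp: supp_def)
    have "z $ i * (column i A \<bullet> y) \<le> \<bar>z $ i\<bar> * \<bar>column i A \<bullet> y\<bar>"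
      by (metis abs_ge_self abs_mult)
    also have "\<dots> < \<bar>z $ i\<bar>"
      using off[OF i(1)] i(2) by simp
    finally have "b \<bullet> y < l1_norm z"
      unfolding l1_norm_def z(1)[symmetric] inner_matrix_vector_mult
      using le by (intro sum_strict_mono_ex1) auto
    with x show ?thesis by simp
  qed
  have "is_arg_min l1_norm (\<lambda>z. A *v z = b) z \<longleftrightarrow> z = x" for z
    unfolding is_arg_min_def using less feas by (metis less_asym)
  then show ?thesis
    by (auto simp: bp_solutions_def)
qed

theorem theorem2:
  fixes A :: "real ^ 'n ^ 'm" and b :: "real ^ 'm" and xs :: "real ^ 'n"
  assumes "rank A = CARD('m)"
    and "bp_solutions A b \<noteq> {}"
  shows "bp_solutions A b = {xs} \<longleftrightarrow>
    A *v xs = b \<and>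
    full_column_rank A (supp xs) \<and>
    (\<exists>y :: real ^ 'm.
       transpose (column_submatrix A (supp xs)) *v y = sign_vec (subvec xs (supp xs)) \<and>
       infnorm (transpose (column_submatrix A (- supp xs)) *v y) < 1)"
  unfolding column_submatrix_transpose_eq_iff infnorm_column_submatrix_less_iff
proof
  assume uniq: "bp_solutions A b = {xs}"
  then have "xs \<in> bp_solutions A b"
    by simp
  then have "A *v xs = b"
    by (simp add: bp_solutions_def is_arg_min_def)
  moreover note pos = unique_bp_solution_dir_deriv_pos[OF uniq]
  moreover obtain y where "\<And>j. j \<in> supp xs \<Longrightarrow> column j A \<bullet> y = sgn (xs $ j)"
    and "\<And>j. j \<notin> supp xs \<Longrightarrow> \<bar>column j A \<bullet> y\<bar> < 1"
    using dual_certificate_exists[OF pos] by blast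
  ultimately show "A *v xs = b \<and> full_column_rank A (supp xs) \<and>
      (\<exists>y. (\<forall>j\<in>supp xs. column j A \<bullet> y = sgn (xs $ j)) \<and> (\<forall>j\<in>- supp xs. \<bar>column j A \<bullet> y\<bar> < 1))"
    using full_column_rank_supp[OF pos] by auto
next
  assume "A *v xs = b \<and> full_column_rank A (supp xs) \<and>
      (\<exists>y. (\<forall>j\<in>supp xs. column j A \<bullet> y = sgn (xs $ j)) \<and> (\<forall>j\<in>- supp xs. \<bar>column j A \<bullet> y\<bar> < 1))"
  then show "bp_solutions A b = {xs}"
    by (metis ComplI bp_solutions_eq_singletonI)
qed

end
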